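(* Let $\mathcal{H}$ be a real Hilbert space, let $C\subset\mathcal{H}$ be nonempty, convex, and compact, and let $\varepsilon>0$. Suppose that real number arithmetic operations can be performed and that, for all $x\in\mathcal{H}$, projection onto $C$ and $\varepsilon$-approximate linear minimization over $C$ can be performed using finitely many real vector-arithmetic operations. Let $P$ and $L(\varepsilon)$ respectively denote the smallest number of such operations required (the worst-case complexity of an optimal algorithm) for projection onto $C$ and for $\varepsilon$-approximate linear minimization over $C$. Then $P+1\geq L(\varepsilon)$. In consequence, if $P\geq 1$ and $\mathcal{H}$ is finite-dimensional, then $\mathcal{O}(P)\geq\mathcal{O}(L(\varepsilon))$.
   Context: $\mathcal{H}$ has inner product $\langle\cdot\mid\cdot\rangle$ and induced norm $\|\cdot\|$. Projection onto $C$ at $x\in\mathcal{H}$ means computing $\mathrm{Proj}_C(x)$, the unique minimizer of $c\mapsto\|c-x\|$ over $C$. $\varepsilon$-approximate linear minimization over $C$ at $x$ means computing an $\varepsilon$-approximate LMO of $x$, i.e., a point $v\in C$ such that $0\leq\langle v\mid x\rangle-\min_{c\in C}\langle c\mid x\rangle\leq\varepsilon$. Computational cost is measured in the real-arithmetic model by counting real vector-arithmetic operations; multiplication of a vector by a real scalar counts as one operation. $P$ and $L(\varepsilon)$ are worst-case over inputs $x\in\mathcal{H}$ and minimal over algorithms; their dependence on $C$ and on the dimension of $\mathcal{H}$ is suppressed in the notation. $\mathcal{O}(P)\geq\mathcal{O}(L(\varepsilon))$ means that $L(\varepsilon)$ is $\mathcal{O}(P)$. *)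

theory Defs
  imports "HOL-Analysis.Analysis" "HOL-Library.Landau_Symbols"
begin

text \<open>
  A real Hilbert space is a complete linear subspace of an ambient inner product space.
  Carriers are sets rather than types, so that spaces of different dimensions can occur in one
  asymptotic statement.
\<close>

definition hilbert_space :: "'a::real_inner set \<Rightarrow> bool" where
  "hilbert_space H \<longleftrightarrow> subspace H \<and> complete H"

definition finite_dimensional_space :: "'a::real_vector set \<Rightarrow> bool" where
  "finite_dimensional_space H \<longleftrightarrow> (\<exists>B. finite B \<and> H = span B)"

text \<open>
  The library constant \<^term>\<open>closest_point\<close> is restricted to spaces with the Heine-Borel property,
  which excludes infinite-dimensional Hilbert spaces. In \<open>Proj\<close> and \<open>approx_LMO\<close>, the minima are
  attained for nonempty convex compact \<open>C\<close>.
\<close>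

definition Proj :: "'a::real_inner set \<Rightarrow> 'a \<Rightarrow> 'a" where
  "Proj C x = (THE p. is_arg_min (\<lambda>c. norm (c - x)) (\<lambda>c. c \<in> C) p)"

definition approx_LMO :: "'a::real_inner set \<Rightarrow> real \<Rightarrow> 'a \<Rightarrow> 'a \<Rightarrow> bool" where
  "approx_LMO C \<epsilon> x v \<longleftrightarrow> v \<in> C \<and>
     0 \<le> v \<bullet> x - (LEAST m. m \<in> (\<lambda>c. c \<bullet> x) ` C) \<and>
     v \<bullet> x - (LEAST m. m \<in> (\<lambda>c. c \<bullet> x) ` C) \<le> \<epsilon>"

text \<open>
  The real-arithmetic model: programs over finitely many scalar and vector registers, with exact
  real arithmetic and comparison. The first argument of an instruction is its target register.
  Division by zero has the value 0; as tests and scalar operations are not counted, a program can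
  equally well guard its divisions at no cost.
\<close>

datatype (vec_constants: 'a) instr =
    SConst nat real
  | SCopy nat nat
  | SAdd nat nat nat
  | SSub nat nat nat
  | SMul nat nat nat
  | SDiv nat nat nat
  | VConst nat 'a
  | VCopy nat nat
  | VAdd nat nat nat
  | VSub nat nat nat
  | VScale nat nat nat
  | VInner nat nat nat
  | VNorm nat nat

datatype (prog_constants: 'a) prog =
    Skip
  | Instr "'a instr"
  | Seq "'a prog" "'a prog"
  | IfLess nat nat "'a prog" "'a prog"
  | WhileLess nat nat "'a prog"

type_synonym 'a state = "(nat \<Rightarrow> real) \<times> (nat \<Rightarrow> 'a)"

fun step :: "'a::real_inner instr \<Rightarrow> 'a state \<Rightarrow> 'a state" where
  "step (SConst k a) (s, v) = (s(k := a), v)"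
| "step (SCopy k i) (s, v) = (s(k := s i), v)"
| "step (SAdd k i j) (s, v) = (s(k := s i + s j), v)"
| "step (SSub k i j) (s, v) = (s(k := s i - s j), v)"
| "step (SMul k i j) (s, v) = (s(k := s i * s j), v)"
| "step (SDiv k i j) (s, v) = (s(k := s i / s j), v)"
| "step (VConst k a) (s, v) = (s, v(k := a))"
| "step (VCopy k i) (s, v) = (s, v(k := v i))"
| "step (VAdd k i j) (s, v) = (s, v(k := v i + v j))"
| "step (VSub k i j) (s, v) = (s, v(k := v i - v j))"
| "step (VScale k i j) (s, v) = (s, v(k := s i *\<^sub>R v j))"
| "step (VInner k i j) (s, v) = (s(k := v i \<bullet> v j), v)"
| "step (VNorm k i) (s, v) = (s(k := norm (v i)), v)"

text \<open>
  Only vector arithmetic is counted. Loading a constant, which is part of the program text,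
  and copying a register are not arithmetic operations.
\<close>

fun vector_ops :: "'a instr \<Rightarrow> nat" where
  "vector_ops (VAdd k i j) = 1"
| "vector_ops (VSub k i j) = 1"
| "vector_ops (VScale k i j) = 1"
| "vector_ops (VInner k i j) = 1"
| "vector_ops (VNorm k i) = 1"
| "vector_ops _ = 0"

text \<open>
  \<open>exec p s n t\<close>: started in state \<open>s\<close>, the program \<open>p\<close> terminates in state \<open>t\<close> after
  \<open>n\<close> vector-arithmetic operations.
\<close>

inductive exec :: "'a::real_inner prog \<Rightarrow> 'a state \<Rightarrow> nat \<Rightarrow> 'a state \<Rightarrow> bool" where
  Skip: "exec Skip s 0 s"
| Instr: "exec (Instr c) s (vector_ops c) (step c s)"
| Seq: "exec p s m t \<Longrightarrow> exec q t n u \<Longrightarrow> exec (Seq p q) s (m + n) u"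
| IfTrue: "fst s i < fst s j \<Longrightarrow> exec p s n t \<Longrightarrow> exec (IfLess i j p q) s n t"
| IfFalse: "\<not> fst s i < fst s j \<Longrightarrow> exec q s n t \<Longrightarrow> exec (IfLess i j p q) s n t"
| WhileFalse: "\<not> fst s i < fst s j \<Longrightarrow> exec (WhileLess i j p) s 0 s"
| WhileTrue: "fst s i < fst s j \<Longrightarrow> exec p s m t \<Longrightarrow> exec (WhileLess i j p) t n u \<Longrightarrow>
    exec (WhileLess i j p) s (m + n) u"

inductive_cases exec_SkipE: "exec Skip s n t"
inductive_cases exec_InstrE: "exec (Instr c) s n t"
inductive_cases exec_SeqE: "exec (Seq p q) s n t"
inductive_cases exec_IfE: "exec (IfLess i j p q) s n t"
inductive_cases exec_WhileE: "exec (WhileLess i j p) s n t"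

lemma exec_deterministic:
  "exec p s n t \<Longrightarrow> exec p s n' t' \<Longrightarrow> n' = n \<and> t' = t"
proof (induction arbitrary: n' t' rule: exec.induct)
  case (Skip s)
  then show ?case by (auto elim: exec_SkipE)
next
  case (Instr c s)
  then show ?case by (auto elim: exec_InstrE)
next
  case (Seq p s m t q n u)
  from Seq.prems show ?case by (rule exec_SeqE) (use Seq.IH in blast)
next
  case (IfTrue s i j p n t q)
  from IfTrue.prems show ?case by (rule exec_IfE) (use IfTrue in blast)+
next
  case (IfFalse s i j q n t p)
  from IfFalse.prems show ?case by (rule exec_IfE) (use IfFalse in blast)+
next
  case (WhileFalse s i j p)
  from WhileFalse.prems show ?case by (rule exec_WhileE) (use WhileFalse in blast)+
next
  case (WhileTrue s i j p m t n u)
  from WhileTrue.prems show ?case by (rule exec_WhileE) (use WhileTrue in blast)+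
qed

text \<open>The input is placed in, and the output is read from, vector register 0.\<close>

definition initial :: "'a::real_inner \<Rightarrow> 'a state" where
  "initial x = ((\<lambda>_. 0), (\<lambda>_. 0)(0 := x))"

text \<open>
  A problem on \<open>H\<close> is a relation between inputs and acceptable outputs. The program may depend on
  the problem, but not on the input; \<open>N\<close> bounds its cost in the worst case over all inputs.
\<close>

definition solves_within :: "'a::real_inner set \<Rightarrow> ('a \<Rightarrow> 'a \<Rightarrow> bool) \<Rightarrow> 'a prog \<Rightarrow> nat \<Rightarrow> bool" where
  "solves_within H R p N \<longleftrightarrow> prog_constants p \<subseteq> H \<and>
     (\<forall>x\<in>H. \<exists>n t. exec p (initial x) n t \<and> n \<le> N \<and> R x (snd t 0))"

definition finitely_solvable :: "'a::real_inner set \<Rightarrow> ('a \<Rightarrow> 'a \<Rightarrow> bool) \<Rightarrow> bool" where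
  "finitely_solvable H R \<longleftrightarrow> (\<exists>p N. solves_within H R p N)"

definition complexity :: "'a::real_inner set \<Rightarrow> ('a \<Rightarrow> 'a \<Rightarrow> bool) \<Rightarrow> nat" where
  "complexity H R = (LEAST N. \<exists>p. solves_within H R p N)"

abbreviation projection_problem :: "'a::real_inner set \<Rightarrow> 'a \<Rightarrow> 'a \<Rightarrow> bool" where
  "projection_problem C \<equiv> (\<lambda>x y. y = Proj C x)"

definition proj_complexity :: "'a::real_inner set \<Rightarrow> 'a set \<Rightarrow> nat" where
  "proj_complexity H C = complexity H (projection_problem C)"

definition lmo_complexity :: "'a::real_inner set \<Rightarrow> 'a set \<Rightarrow> real \<Rightarrow> nat" where
  "lmo_complexity H C \<epsilon> = complexity H (approx_LMO C \<epsilon>)"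

end

theory Submission
  imports Defs
begin

text \<open>
  For \<open>p = Proj C (a *\<^sub>R x)\<close> with \<open>a < 0\<close>, the variational characterisation of the projection
  reads \<open>(c - p) \<bullet> (p - a *\<^sub>R x) \<ge> 0\<close> for all \<open>c \<in> C\<close>, hence
  \<open>p \<bullet> x - c \<bullet> x \<le> (c - p) \<bullet> p / \<bar>a\<bar> \<le> B\<^sup>2 / \<bar>a\<bar>\<close> if \<open>B\<close> bounds the norms on \<open>C\<close>.
  With \<open>a = - B\<^sup>2 / \<epsilon>\<close>, a constant that does not depend on \<open>x\<close>, this is an \<open>\<epsilon>\<close>-approximate LMO,
  at the cost of a projection and one scaling of \<open>x\<close>.
\<close>

lemma nearest_point_inner_nonneg:
  fixes C :: "'a::real_inner set"
  assumes "convex C" "closed C" "is_arg_min (\<lambda>c. norm (c - y)) (\<lambda>c. c \<in> C) p" "c \<in> C"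
  shows "0 \<le> (c - p) \<bullet> (p - y)"
proof -
  from assms(3) have "p \<in> C" "\<forall>z\<in>C. dist y p \<le> dist y z"
    by (auto simp: is_arg_min_linorder dist_norm norm_minus_commute)
  then have "(y - p) \<bullet> (c - p) \<le> 0"
    using any_closest_point_dot assms(1,2,4) by blast
  then show ?thesis by (simp add: algebra_simps inner_commute)
qed

text \<open>Compactness gives a minimizer and convexity makes it unique, so the \<open>THE\<close>
  in \<open>Proj\<close> denotes it.\<close>

lemma is_arg_min_Proj:
  fixes C :: "'a::real_inner set"
  assumes "convex C" "compact C" "C \<noteq> {}"
  shows "is_arg_min (\<lambda>c. norm (c - y)) (\<lambda>c. c \<in> C) (Proj C y)"
proof -
  let ?P = "is_arg_min (\<lambda>c. norm (c - y)) (\<lambda>c. c \<in> C)"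
  have "\<exists>p\<in>C. \<forall>c\<in>C. norm (p - y) \<le> norm (c - y)"
    using assms by (intro continuous_attains_inf continuous_intros) auto
  then obtain p where p: "?P p"
    by (auto simp: is_arg_min_linorder)
  have "q = p" if q: "?P q" for q
  proof -
    have "0 \<le> (q - p) \<bullet> (p - y)" "0 \<le> (p - q) \<bullet> (q - y)"
      using p q nearest_point_inner_nonneg[OF assms(1) compact_imp_closed[OF assms(2)]] by (auto simp: is_arg_min_def)
    \<comment> \<open>Adding the variational inequalities of two minimizers, each tested at the
      other, cancels \<open>y\<close> and leaves minus their squared distance.\<close>
    moreover have "(q - p) \<bullet> (p - y) + (p - q) \<bullet> (q - y) = - ((q - p) \<bullet> (q - p))"
      by (simp add: algebra_simps inner_commute)
    ultimately have "(q - p) \<bullet> (q - p) \<le> 0" by simp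
    then show "q = p" by (metis inner_gt_zero_iff not_le right_minus_eq)
  qed
  with p show ?thesis
    unfolding Proj_def by (rule theI)
qed

lemma Proj_scaleR_approx_LMO:
  fixes C :: "'a::real_inner set"
  assumes C: "convex C" "compact C" "C \<noteq> {}"
    and B: "\<And>c. c \<in> C \<Longrightarrow> norm c \<le> B" "0 < B" and eps: "0 < \<epsilon>"
  shows "approx_LMO C \<epsilon> x (Proj C ((- (B\<^sup>2 / \<epsilon>)) *\<^sub>R x))"
proof -
  define r where "r = B\<^sup>2 / \<epsilon>"
  define p where "p = Proj C ((- r) *\<^sub>R x)"
  have r: "0 < r" "r * \<epsilon> = B\<^sup>2" using B(2) eps by (auto simp: r_def)
  have min: "is_arg_min (\<lambda>c. norm (c - (- r) *\<^sub>R x)) (\<lambda>c. c \<in> C) p"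
    unfolding p_def by (rule is_arg_min_Proj[OF C])
  then have p: "p \<in> C" by (simp add: is_arg_min_def)
  have bound: "p \<bullet> x - c \<bullet> x \<le> \<epsilon>" if c: "c \<in> C" for c
  proof -
    \<comment> \<open>The variational inequality at \<open>y = (- r) *\<^sub>R x\<close>, solved for
      the linear gap.\<close>
    have "r * (p \<bullet> x - c \<bullet> x) \<le> c \<bullet> p - p \<bullet> p"
      using nearest_point_inner_nonneg[OF C(1) compact_imp_closed[OF C(2)] min c] by (simp add: algebra_simps)
    also have "\<dots> \<le> c \<bullet> p" by simp
    also have "\<dots> \<le> norm c * norm p" by (rule norm_cauchy_schwarz)
    also have "\<dots> \<le> B * B" using B p c by (intro mult_mono) auto
    also have "\<dots> = r * \<epsilon>" by (simp add: r power2_eq_square)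
    finally show ?thesis using r(1) by simp
  qed
  have "\<exists>m\<in>C. \<forall>c\<in>C. m \<bullet> x \<le> c \<bullet> x"
    using C by (intro continuous_attains_inf continuous_intros) auto
  then obtain m where m: "m \<in> C" "\<And>c. c \<in> C \<Longrightarrow> m \<bullet> x \<le> c \<bullet> x" by blast
  \<comment> \<open>A \<open>LEAST\<close> over the reals is meaningful only once the minimum is
    known to be attained, here at \<open>m\<close>.\<close>
  then have "(LEAST m. m \<in> (\<lambda>c. c \<bullet> x) ` C) = m \<bullet> x"
    by (intro Least_equality) auto
  with m p bound show ?thesis
    unfolding r_def[symmetric] p_def[symmetric] approx_LMO_def by auto
qed

text \<open>Prefixing a program with one scaling of its input reduces \<open>R'\<close> to
  \<open>R\<close>. The factor \<open>a\<close> may be hard-coded because it is the same for all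
  inputs.\<close>

lemma solves_within_scaled_input:
  fixes H :: "'a::real_inner set"
  assumes "subspace H" and p: "solves_within H R p N"
    and R: "\<And>x y. x \<in> H \<Longrightarrow> R (a *\<^sub>R x) y \<Longrightarrow> R' x y"
  shows "\<exists>q. solves_within H R' q (N + 1)"
proof -
  \<comment> \<open>Resetting the scalar register makes the state before \<open>p\<close> equal to \<open>initial (a *\<^sub>R x)\<close>.\<close>
  let ?q = "Seq (Seq (Seq (Instr (SConst 0 a)) (Instr (VScale 0 0 0))) (Instr (SConst 0 0))) p"
  have "\<exists>n t. exec ?q (initial x) n t \<and> n \<le> N + 1 \<and> R' x (snd t 0)" if x: "x \<in> H" for x
  proof -
    have "a *\<^sub>R x \<in> H" using assms(1) x by (rule subspace_scale)
    with p obtain n t where nt: "exec p (initial (a *\<^sub>R x)) n t" "n \<le> N" "R (a *\<^sub>R x) (snd t 0)"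
      unfolding solves_within_def by blast
    have scale: "step (SConst 0 0) (step (VScale 0 0 0) (step (SConst 0 a) (initial x)))
        = initial (a *\<^sub>R x)"
      by (auto simp: initial_def fun_eq_iff)
    have "exec ?q (initial x)
        (vector_ops (SConst 0 a :: 'a instr) + vector_ops (VScale 0 0 0 :: 'a instr)
          + vector_ops (SConst 0 0 :: 'a instr) + n) t"
      by (rule exec.Seq exec.Instr)+ (simp only: scale nt(1))
    \<comment> \<open>Loading scalar constants is free, so the prefix costs exactly the one
      \<open>VScale\<close>.\<close>
    with nt R[OF x] show ?thesis by (intro exI[of _ "Suc n"] exI[of _ t]) auto
  qed
  \<comment> \<open>The prefix contains only scalar constants, so all vector constants come from
    \<open>p\<close>.\<close>
  moreover have "prog_constants ?q \<subseteq> H"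
    using p by (auto simp: solves_within_def)
  ultimately show ?thesis unfolding solves_within_def by blast
qed

lemma lmo_complexity_le_proj_complexity:
  fixes H C :: "'a::real_inner set"
  assumes "subspace H" and C: "convex C" "compact C" "C \<noteq> {}" and "0 < \<epsilon>"
    and "finitely_solvable H (projection_problem C)"
  shows "lmo_complexity H C \<epsilon> \<le> proj_complexity H C + 1"
proof -
  \<comment> \<open>Finite solvability ensures that the \<open>LEAST\<close> is attained, so an
    optimal projection program exists.\<close>
  obtain p where p: "solves_within H (projection_problem C) p (proj_complexity H C)"
    using assms(6) LeastI_ex[of "\<lambda>N. \<exists>p. solves_within H (projection_problem C) p N"]
    unfolding finitely_solvable_def proj_complexity_def complexity_def by blast
  \<comment> \<open>A strictly positive bound keeps the scaling factor nonzero even for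
    \<open>C = {0}\<close>.\<close>
  obtain B where B: "0 < B" "\<And>c. c \<in> C \<Longrightarrow> norm c \<le> B"
    using compact_imp_bounded[OF C(2)] unfolding bounded_pos by blast
  have "\<exists>q. solves_within H (approx_LMO C \<epsilon>) q (proj_complexity H C + 1)"
    using Proj_scaleR_approx_LMO[OF C B(2,1) assms(5)]
    by (intro solves_within_scaled_input[OF assms(1) p, where a = "- (B\<^sup>2 / \<epsilon>)"]) auto
  then show ?thesis
    unfolding lmo_complexity_def complexity_def by (rule Least_le)
qed

theorem corollary1:
  fixes H C :: "'i \<Rightarrow> 'a::real_inner set" and \<epsilon> :: "'i \<Rightarrow> real" and F :: "'i filter"
  assumes "\<And>i. hilbert_space (H i)"
    and "\<And>i. C i \<subseteq> H i"
    and "\<And>i. C i \<noteq> {}"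
    and "\<And>i. convex (C i)"
    and "\<And>i. compact (C i)"
    and "\<And>i. \<epsilon> i > 0"
    and "\<And>i. finitely_solvable (H i) (projection_problem (C i))"
    and "\<And>i. finitely_solvable (H i) (approx_LMO (C i) (\<epsilon> i))"
  shows "(\<forall>i. proj_complexity (H i) (C i) + 1 \<ge> lmo_complexity (H i) (C i) (\<epsilon> i)) \<and>
    ((\<forall>i. proj_complexity (H i) (C i) \<ge> 1 \<and> finite_dimensional_space (H i)) \<longrightarrow>
      (\<lambda>i. real (lmo_complexity (H i) (C i) (\<epsilon> i)))
        \<in> O[F](\<lambda>i. real (proj_complexity (H i) (C i))))"
proof -
  have le: "lmo_complexity (H i) (C i) (\<epsilon> i) \<le> proj_complexity (H i) (C i) + 1" for i
    using assms by (intro lmo_complexity_le_proj_complexity) (auto simp: hilbert_space_def)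
  have "(\<lambda>i. real (lmo_complexity (H i) (C i) (\<epsilon> i)))
      \<in> O[F](\<lambda>i. real (proj_complexity (H i) (C i)))"
    if P: "\<forall>i. proj_complexity (H i) (C i) \<ge> 1"
  proof (rule bigoI[of _ 2])
    \<comment> \<open>As the projection complexity is at least 1, adding 1 at most doubles it; hence
      the constant 2.\<close>
    have "real (lmo_complexity (H i) (C i) (\<epsilon> i)) \<le> 2 * real (proj_complexity (H i) (C i))" for i
      using le[of i] spec[OF P, of i] by linarith
    then show "\<forall>\<^sub>F i in F. norm (real (lmo_complexity (H i) (C i) (\<epsilon> i)))
        \<le> 2 * norm (real (proj_complexity (H i) (C i)))"
      by (simp add: always_eventually)
  qed
  with le show ?thesis by blast
qed

end
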